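(* Let $f$ be a real-valued function that is smooth ($C^\infty$) in a neighbourhood of a point $x_i\in\mathbb{R}$, with $f'(x_i)=0$ and $f''(x_i)\neq0$. For small $\Delta x>0$ put $f_{i+j}=f(x_i+j\Delta x)$, $j=-2,\dots,2$, and let $\omega_0,\omega_1,\omega_2$ be the WENO-UD5 nonlinear weights with exponent $p=2$ and $\epsilon=0$, i.e. $$\omega_k=\frac{\alpha_k}{\alpha_0+\alpha_1+\alpha_2},\qquad \alpha_k=d_k\left(1+\left(\frac{\zeta}{\beta_k}\right)^{2}\right),\qquad k=0,1,2,$$ where $d_0=\tfrac1{10}$, $d_1=\tfrac{6}{10}$, $d_2=\tfrac{3}{10}$ and $\beta_k$, $\zeta$ are the local and global smoothness indicators given in the context. Then the weights satisfy the sufficient condition for fifth-order accuracy, $$\omega_k-d_k=O(\Delta x^3)\quad\text{as }\Delta x\to0,\qquad k=0,1,2.$$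
   Context: The local smoothness indicators (built from undivided differences) are $$\beta_0=\tfrac12\big((f_{i-1}-f_{i-2})^2+(f_i-f_{i-1})^2\big)+(f_i-2f_{i-1}+f_{i-2})^2,$$ $$\beta_1=\tfrac12\big((f_i-f_{i-1})^2+(f_{i+1}-f_i)^2\big)+(f_{i-1}-2f_i+f_{i+1})^2,$$ $$\beta_2=\tfrac12\big((f_{i+1}-f_i)^2+(f_{i+2}-f_{i+1})^2\big)+(f_{i+2}-2f_{i+1}+f_i)^2,$$ and the global smoothness indicator is $$\zeta=\Big|(f_{i-2}-2f_{i-1}+f_i)^2-2(f_{i-1}-2f_i+f_{i+1})^2+(f_i-2f_{i+1}+f_{i+2})^2\Big|.$$ The point $x_i$ and the function $f$ are fixed and the asymptotics are for $\Delta x\to0^+$; the weights are defined for all sufficiently small $\Delta x$. *)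

theory Defs
  imports "HOL-Analysis.Analysis" "HOL-Library.Landau_Symbols"
begin

text \<open>Meaningful for open \<open>S\<close>: there the values of \<open>(deriv ^^ n) f\<close> on \<open>S\<close> depend only on \<open>f\<close>
  restricted to \<open>S\<close>, and differentiability of all of them says that \<open>f\<close> is \<open>C\<^sup>\<infinity>\<close> on \<open>S\<close>.\<close>

definition smooth_on :: "real set \<Rightarrow> (real \<Rightarrow> real) \<Rightarrow> bool" where
  "smooth_on S f \<longleftrightarrow> (\<forall>n. \<forall>y\<in>S. (deriv ^^ n) f field_differentiable (at y))"

text \<open>Below, \<open>u j\<close> stands for \<open>f\<^sub>i\<^sub>+\<^sub>j\<close>; the stencil index \<open>k\<close> ranges over \<open>0, 1, 2\<close>.\<close>

definition stencil :: "(real \<Rightarrow> real) \<Rightarrow> real \<Rightarrow> real \<Rightarrow> int \<Rightarrow> real" where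
  "stencil f x h j = f (x + of_int j * h)"

definition ideal_weight :: "nat \<Rightarrow> real" where
  "ideal_weight k = (if k = 0 then 1/10 else if k = 1 then 6/10 else 3/10)"

definition local_smoothness :: "(int \<Rightarrow> real) \<Rightarrow> nat \<Rightarrow> real" where
  "local_smoothness u k =
    (if k = 0 then
       1/2 * ((u (-1) - u (-2))^2 + (u 0 - u (-1))^2) + (u 0 - 2 * u (-1) + u (-2))^2
     else if k = 1 then
       1/2 * ((u 0 - u (-1))^2 + (u 1 - u 0)^2) + (u (-1) - 2 * u 0 + u 1)^2
     else
       1/2 * ((u 1 - u 0)^2 + (u 2 - u 1)^2) + (u 2 - 2 * u 1 + u 0)^2)"

definition global_smoothness :: "(int \<Rightarrow> real) \<Rightarrow> real" where
  "global_smoothness u =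
    \<bar>(u (-2) - 2 * u (-1) + u 0)^2 - 2 * (u (-1) - 2 * u 0 + u 1)^2
      + (u 0 - 2 * u 1 + u 2)^2\<bar>"

definition unnormalized_weight :: "(int \<Rightarrow> real) \<Rightarrow> nat \<Rightarrow> real" where
  "unnormalized_weight u k =
    ideal_weight k * (1 + (global_smoothness u / local_smoothness u k)^2)"

text \<open>The denominator is at least \<open>1\<close>, so the weights are well defined exactly when no
  \<open>local_smoothness u k\<close> vanishes.\<close>

definition nonlinear_weight :: "(int \<Rightarrow> real) \<Rightarrow> nat \<Rightarrow> real" where
  "nonlinear_weight u k =
    unnormalized_weight u k
      / (unnormalized_weight u 0 + unnormalized_weight u 1 + unnormalized_weight u 2)"

end

theory Submission
  imports Defs "HOL-Real_Asymp.Real_Asymp"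
begin

text \<open>Each \<open>\<beta>\<^sub>k\<close> dominates the square of its second difference, which is asymptotic to
  \<open>f''(x) h\<^sup>2\<close>; hence \<open>h\<^sup>4 = O(\<beta>\<^sub>k)\<close>. The second differences centred at \<open>-1, 0, 1\<close> are
  \<open>f''(x) h\<^sup>2 + c f'''(x) h\<^sup>3 + O(h\<^sup>4)\<close> with \<open>c = -1, 0, 1\<close>, so in \<open>\<zeta>\<close> the terms of order
  \<open>h\<^sup>4\<close> and \<open>h\<^sup>5\<close> cancel and \<open>\<zeta> = O(h\<^sup>6)\<close>. Thus \<open>(\<zeta>/\<beta>\<^sub>k)\<^sup>2 = O(h\<^sup>4)\<close>, and the deviation
  of the normalized weights from the ideal ones is at most the sum of these three quantities.\<close>

lemma smooth_on_has_real_derivative: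
  assumes "smooth_on S f" and "y \<in> S"
  shows "((deriv ^^ n) f has_real_derivative (deriv ^^ Suc n) f y) (at y)"
  using assms by (auto simp: smooth_on_def field_differentiable_derivI)

text \<open>Lagrange form of the remainder: the \<open>n\<close>-th derivative is continuous on a
  compact ball around \<open>x\<close> inside \<open>S\<close>, hence bounded there. The filter is
  \<open>nhds 0\<close>, with \<open>t = 0\<close> included, so that \<open>of_int j * h\<close> can
  be substituted for \<open>t\<close> even when \<open>j = 0\<close>.\<close>

lemma smooth_on_taylor_bigo:
  fixes f :: "real \<Rightarrow> real"
  assumes "open S" and "x \<in> S" and f: "smooth_on S f" and "n > 0"
  shows "(\<lambda>t. f (x + t) - (\<Sum>m<n. (deriv ^^ m) f x / fact m * t ^ m)) \<in> O[nhds 0](\<lambda>t. t ^ n)"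
proof -
  define g where "g = (deriv ^^ n) f"
  obtain e where e: "e > 0" "cball x e \<subseteq> S"
    using assms open_contains_cball by blast
  have deriv: "((deriv ^^ m) f has_real_derivative (deriv ^^ Suc m) f y) (at y)"
    if "\<bar>y - x\<bar> \<le> e" for m y
    using that e(2) by (intro smooth_on_has_real_derivative[OF f])
      (auto simp: dist_real_def abs_minus_commute subset_iff)
  have "continuous_on (cball x e) g"
    unfolding g_def
    by (intro continuous_at_imp_continuous_on ballI DERIV_isCont[OF deriv])
      (auto simp: dist_real_def abs_minus_commute)
  then have "bounded (g ` cball x e)"
    by (intro compact_imp_bounded compact_continuous_image) auto
  then obtain M where M: "\<And>y. y \<in> cball x e \<Longrightarrow> \<bar>g y\<bar> \<le> M"
    unfolding bounded_real by blast
  have bound: "\<bar>f (x + t) - (\<Sum>m<n. (deriv ^^ m) f x / fact m * t ^ m)\<bar> \<le> M / fact n * \<bar>t ^ n\<bar>"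
    if t: "\<bar>t\<bar> < e" for t
  proof (cases "t = 0")
    \<comment> \<open>\<open>Taylor\<close> requires a point different from the centre of expansion;
      at \<open>t = 0\<close> only the term \<open>m = 0\<close> survives and the difference
      vanishes.\<close>
    case True
    have "(\<Sum>m<n. (deriv ^^ m) f x / fact m * 0 ^ m) = (\<Sum>m\<in>{0}. (deriv ^^ m) f x / fact m * 0 ^ m)"
      using \<open>n > 0\<close> by (intro sum.mono_neutral_right) auto
    with True \<open>n > 0\<close> show ?thesis by (simp add: zero_power)
  next
    case False
    have "\<exists>s. (if x + t < x then x + t < s \<and> s < x else x < s \<and> s < x + t) \<and>
      f (x + t) = (\<Sum>m<n. ((deriv ^^ m) f x / fact m) * (x + t - x) ^ m)
        + ((deriv ^^ n) f s / fact n) * (x + t - x) ^ n"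
    proof (rule Taylor[where a = "x - e" and b = "x + e" and diff = "\<lambda>m. (deriv ^^ m) f"])
      show "\<forall>m s. m < n \<and> x - e \<le> s \<and> s \<le> x + e \<longrightarrow>
          ((deriv ^^ m) f has_real_derivative (deriv ^^ Suc m) f s) (at s)"
        by (intro allI impI deriv) auto
    qed (use \<open>n > 0\<close> e(1) t False in auto)
    then obtain s where s: "if t < 0 then x + t < s \<and> s < x else x < s \<and> s < x + t"
      and eq: "f (x + t) - (\<Sum>m<n. (deriv ^^ m) f x / fact m * t ^ m) = g s / fact n * t ^ n"
      by (auto simp: g_def)
    have "s \<in> cball x e"
      using s t by (auto simp: dist_real_def split: if_splits)
    then have "\<bar>g s\<bar> / fact n * \<bar>t ^ n\<bar> \<le> M / fact n * \<bar>t ^ n\<bar>"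
      by (intro mult_right_mono divide_right_mono M) auto
    then show ?thesis
      unfolding eq by (simp add: abs_mult)
  qed
  have "eventually (\<lambda>t. \<bar>t\<bar> < e) (nhds (0::real))"
    using e(1) by (auto simp: eventually_nhds_metric dist_real_def)
  then show ?thesis
    by (intro bigoI[where c = "M / fact n"]) (erule eventually_mono, unfold real_norm_def, rule bound)
qed

definition second_difference :: "(int \<Rightarrow> real) \<Rightarrow> int \<Rightarrow> real" where
  "second_difference u c = u (c - 1) - 2 * u c + u (c + 1)"

lemma stencil_taylor_bigo:
  assumes "open S" and "x \<in> S" and "smooth_on S f" and "n > 0"
  shows "(\<lambda>h. stencil f x h j - (\<Sum>m<n. (deriv ^^ m) f x / fact m * (of_int j * h) ^ m))
    \<in> O[at_right 0](\<lambda>h. h ^ n)"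
proof -
  have "((\<lambda>h::real. of_int j * h) \<longlongrightarrow> of_int j * 0) (at_right 0)"
    by (intro tendsto_intros)
  then have "filterlim (\<lambda>h::real. of_int j * h) (nhds 0) (at_right 0)"
    by simp
  from landau_o.big.compose[OF smooth_on_taylor_bigo[OF assms] this]
  have "(\<lambda>h. stencil f x h j - (\<Sum>m<n. (deriv ^^ m) f x / fact m * (of_int j * h) ^ m))
    \<in> O[at_right 0](\<lambda>h. (of_int j * h) ^ n)"
    by (simp add: stencil_def)
  also have "(\<lambda>h::real. (of_int j * h) ^ n) \<in> O[at_right 0](\<lambda>h. h ^ n)"
    by (simp add: power_mult_distrib)
  finally show ?thesis .
qed

text \<open>Expand to degree 3. The second difference centred at \<open>c\<close> kills constant and
  linear terms, sends \<open>j^2\<close> to \<open>2\<close> and \<open>j^3\<close> to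
  \<open>6 * c\<close>; the factorials cancel the \<open>2\<close> and the \<open>6\<close>. Each of
  the three remainders is O(\<open>h^4\<close>).\<close>

lemma second_difference_stencil_bigo:
  assumes "open S" and "x \<in> S" and "smooth_on S f"
  shows "(\<lambda>h. second_difference (stencil f x h) c
      - ((deriv ^^ 2) f x * h ^ 2 + of_int c * (deriv ^^ 3) f x * h ^ 3))
    \<in> O[at_right 0](\<lambda>h. h ^ 4)"
proof -
  define P where "P h j = (\<Sum>m<4. (deriv ^^ m) f x / fact m * (of_int j * h) ^ m)" for h and j :: int
  define R where "R j h = stencil f x h j - P h j" for j h
  have R: "R j \<in> O[at_right 0](\<lambda>h. h ^ 4)" for j
    unfolding R_def P_def using assms by (intro stencil_taylor_bigo) auto
  have P: "second_difference (P h) c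
      = (deriv ^^ 2) f x * h ^ 2 + of_int c * (deriv ^^ 3) f x * h ^ 3" for h
    by (simp add: P_def second_difference_def eval_nat_numeral lessThan_Suc field_simps
          del: funpow.simps)
  have "(\<lambda>h. R (c - 1) h - 2 * R c h + R (c + 1) h) \<in> O[at_right 0](\<lambda>h. h ^ 4)"
    using R by (intro sum_in_bigo) simp_all
  also have "(\<lambda>h. R (c - 1) h - 2 * R c h + R (c + 1) h)
    = (\<lambda>h. second_difference (stencil f x h) c - second_difference (P h) c)"
    by (simp add: R_def second_difference_def algebra_simps)
  finally show ?thesis
    by (simp only: P)
qed

lemma power_bigo_power_at_right_0:
  assumes "m \<le> n"
  shows "(\<lambda>h::real. h ^ n) \<in> O[at_right 0](\<lambda>h. h ^ m)"
proof (rule bigoI[where c = 1])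
  have "eventually (\<lambda>h::real. h \<in> {0<..<1}) (at_right 0)"
    by (rule eventually_at_right_real) simp
  then show "eventually (\<lambda>h::real. norm (h ^ n) \<le> 1 * norm (h ^ m)) (at_right 0)"
    by eventually_elim (use assms in \<open>auto intro: power_decreasing\<close>)
qed

lemma second_difference_stencil_bigtheta:
  assumes "open S" and "x \<in> S" and "smooth_on S f" and a: "(deriv ^^ 2) f x \<noteq> 0"
  shows "(\<lambda>h. second_difference (stencil f x h) c) \<in> \<Theta>[at_right 0](\<lambda>h. h ^ 2)"
proof -
  let ?a = "(deriv ^^ 2) f x" and ?b = "of_int c * (deriv ^^ 3) f x"
  let ?R = "\<lambda>h. second_difference (stencil f x h) c - (?a * h ^ 2 + ?b * h ^ 3)"
  have "?R \<in> O[at_right 0](\<lambda>h. h ^ 4)"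
    using assms by (intro second_difference_stencil_bigo)
  also have "(\<lambda>h::real. h ^ 4) \<in> o[at_right 0](\<lambda>h. h ^ 2)"
    by real_asymp
  finally have R: "?R \<in> o[at_right 0](\<lambda>h. h ^ 2)" .
  have "(\<lambda>h::real. h ^ 3) \<in> o[at_right 0](\<lambda>h. h ^ 2)"
    by real_asymp
  \<comment> \<open>The coefficient may be zero, for instance when \<open>c = 0\<close>, so it can
    be cancelled only after a case split.\<close>
  then have b: "(\<lambda>h. ?b * h ^ 3) \<in> o[at_right 0](\<lambda>h. h ^ 2)"
    by (cases "?b = 0") simp_all
  have "(\<lambda>h. ?R h + ?b * h ^ 3) \<in> o[at_right 0](\<lambda>h. ?a * h ^ 2)"
    using sum_in_smallo(1)[OF R b] a by simp
  then have "(\<lambda>h. second_difference (stencil f x h) c) \<sim>[at_right 0] (\<lambda>h. ?a * h ^ 2)"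
    by (simp add: asymp_equiv_altdef)
  from asymp_equiv_imp_bigtheta[OF this] a show ?thesis
    by simp
qed

text \<open>Replace each second difference \<open>D c\<close> by its two leading terms
  \<open>Q c\<close>. For these the combination is exactly \<open>2 * b^2 * h^6\<close>. Replacing
  the squares costs (\<open>D\<close> - \<open>Q\<close>)(\<open>D\<close> + \<open>Q\<close>), of
  order \<open>h^4\<close> times \<open>h^2\<close>.\<close>

lemma global_smoothness_stencil_bigo:
  assumes "open S" and "x \<in> S" and "smooth_on S f"
  shows "(\<lambda>h. global_smoothness (stencil f x h)) \<in> O[at_right 0](\<lambda>h. h ^ 6)"
proof -
  define a b where "a = (deriv ^^ 2) f x" and "b = (deriv ^^ 3) f x"
  define D where "D c h = second_difference (stencil f x h) c" for c h
  define Q where "Q c h = a * h ^ 2 + of_int c * b * h ^ 3" for c :: int and h :: real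
  have R: "(\<lambda>h. D c h - Q c h) \<in> O[at_right 0](\<lambda>h. h ^ 4)" for c
    unfolding D_def Q_def a_def b_def using assms by (rule second_difference_stencil_bigo)
  have Q: "Q c \<in> O[at_right 0](\<lambda>h. h ^ 2)" for c
    unfolding Q_def by (intro sum_in_bigo) (auto simp: power_bigo_power_at_right_0)
  define E where "E c h = D c h ^ 2 - Q c h ^ 2" for c h
  have E: "E c \<in> O[at_right 0](\<lambda>h. h ^ 6)" for c
  proof -
    have "(\<lambda>h. D c h - Q c h) \<in> O[at_right 0](\<lambda>h. h ^ 2)"
      using R power_bigo_power_at_right_0 by (rule landau_o.big_trans) simp
    \<comment> \<open>Here \<open>D\<close> + \<open>Q\<close> is obtained as (\<open>D\<close> -
      \<open>Q\<close>) + (\<open>Q\<close> + \<open>Q\<close>).\<close>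
    from sum_in_bigo(1)[OF this sum_in_bigo(1)[OF Q[of c] Q[of c]]]
    have "(\<lambda>h. D c h + Q c h) \<in> O[at_right 0](\<lambda>h. h ^ 2)"
      by (simp add: algebra_simps)
    from landau_o.big.mult[OF R this]
    have "(\<lambda>h. (D c h - Q c h) * (D c h + Q c h)) \<in> O[at_right 0](\<lambda>h. h ^ 6)"
      by (simp flip: power_add)
    then show ?thesis
      by (simp add: E_def[abs_def] square_diff_square_factored power2_eq_square mult.commute)
  qed
  \<comment> \<open>The summand \<open>2 * b ^ 2 * h ^ 6\<close> is what the squares of
    \<open>Q\<close> contribute, so the whole equals \<zeta> before the absolute value is
    taken.\<close>
  have "(\<lambda>h. E (-1) h - 2 * E 0 h + E 1 h + 2 * b ^ 2 * h ^ 6) \<in> O[at_right 0](\<lambda>h. h ^ 6)"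
    using E by (intro sum_in_bigo) simp_all
  also have "(\<lambda>h. E (-1) h - 2 * E 0 h + E 1 h + 2 * b ^ 2 * h ^ 6)
    = (\<lambda>h. D (-1) h ^ 2 - 2 * D 0 h ^ 2 + D 1 h ^ 2)"
    by (rule ext) (simp add: E_def Q_def; algebra)
  finally show ?thesis
    by (simp add: global_smoothness_def D_def second_difference_def algebra_simps)
qed

text \<open>The other summands of \<beta>_k are halves of squares. The stencil of \<beta>_k is
  centred at \<open>k - 1\<close>, which explains the index shift.\<close>

lemma local_smoothness_ge:
  assumes "k \<in> {0, 1, 2}"
  shows "(second_difference u (int k - 1))\<^sup>2 \<le> local_smoothness u k"
proof -
  have "u 0 - 2 * u (-1) + u (-2) = second_difference u (-1)"
    "u (-1) - 2 * u 0 + u 1 = second_difference u 0"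
    "u 2 - 2 * u 1 + u 0 = second_difference u 1"
    by (simp_all add: second_difference_def)
  with assms show ?thesis
    by (auto simp: local_smoothness_def)
qed

text \<open>A lower bound on \<beta>_k is the direction wanted, because \<beta>_k stands in a
  denominator.\<close>

lemma local_smoothness_stencil_bigomega:
  assumes "open S" and "x \<in> S" and "smooth_on S f" and "(deriv ^^ 2) f x \<noteq> 0"
    and k: "k \<in> {0, 1, 2}"
  shows "(\<lambda>h. h ^ 4) \<in> O[at_right 0](\<lambda>h. local_smoothness (stencil f x h) k)"
proof -
  have "(\<lambda>h. h ^ 2) \<in> O[at_right 0](\<lambda>h. second_difference (stencil f x h) (int k - 1))"
    using second_difference_stencil_bigtheta[OF assms(1-4)] bigthetaD1 bigtheta_sym by blast
  from landau_o.big_power[OF this, of 2]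
  have "(\<lambda>h. h ^ 4) \<in> O[at_right 0](\<lambda>h. (second_difference (stencil f x h) (int k - 1))\<^sup>2)"
    by (simp flip: power_mult)
  also have "(\<lambda>h. (second_difference (stencil f x h) (int k - 1))\<^sup>2)
      \<in> O[at_right 0](\<lambda>h. local_smoothness (stencil f x h) k)"
    using local_smoothness_ge[OF k]
    by (intro landau_o.big_mono always_eventually allI) (simp add: order.trans[OF _ abs_ge_self])
  finally show ?thesis .
qed

text \<open>With \<open>r j\<close> the squared quotients, the ideal weights sum to 1, so the
  denominator is \<open>1 + s\<close> with \<open>s\<close> a convex combination of the
  \<open>r j\<close>. The deviation is d_k (\<open>r k\<close> - \<open>s\<close>) / (1 +
  \<open>s\<close>), where d_k \<le> 1 and both \<open>r k\<close> and \<open>s\<close> lie between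
  0 and the sum of the \<open>r j\<close>. The bound covers vanishing \<beta>_j too, where the
  quotient is 0 by convention.\<close>

lemma nonlinear_weight_deviation:
  assumes "k \<in> {0, 1, 2}"
  shows "\<bar>nonlinear_weight u k - ideal_weight k\<bar>
    \<le> (\<Sum>j\<in>{0, 1, 2}. (global_smoothness u / local_smoothness u j)\<^sup>2)"
proof -
  define r where "r j = (global_smoothness u / local_smoothness u j)\<^sup>2" for j
  define s where "s = 1/10 * r 0 + 6/10 * r 1 + 3/10 * r 2"
  have r: "r j \<ge> 0" for j by (simp add: r_def)
  have s: "0 \<le> s" "s \<le> r 0 + r 1 + r 2"
    using r[of 0] r[of 1] r[of 2] by (auto simp: s_def)
  have d: "0 \<le> ideal_weight k" "ideal_weight k \<le> 1" by (auto simp: ideal_weight_def)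
  have "unnormalized_weight u 0 + unnormalized_weight u 1 + unnormalized_weight u 2 = 1 + s"
    by (simp add: unnormalized_weight_def ideal_weight_def s_def r_def
        add_divide_distrib)
  then have "nonlinear_weight u k = ideal_weight k * (1 + r k) / (1 + s)"
    by (simp only: nonlinear_weight_def) (simp only: unnormalized_weight_def r_def)
  then have "nonlinear_weight u k - ideal_weight k = ideal_weight k * ((r k - s) / (1 + s))"
    using s(1) by (simp add: field_simps)
  also have "\<bar>\<dots>\<bar> \<le> 1 * \<bar>(r k - s) / (1 + s)\<bar>"
    unfolding abs_mult using d by (intro mult_right_mono) auto
  also have "\<dots> \<le> \<bar>r k - s\<bar>"
    using s(1) by (simp add: divide_le_eq mult_le_cancel_left1 distrib_left)
  also have "\<dots> \<le> r 0 + r 1 + r 2"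
    using s r[of 0] r[of 1] r[of 2] assms by auto
  finally show ?thesis
    by (simp add: r_def)
qed

text \<open>The first conjunct ensures that, for small \<open>h\<close>, no quotient takes the
  default value of division by zero, so the weights are the intended ones.\<close>

theorem mainTheorem2:
  fixes f :: "real \<Rightarrow> real" and x :: real and S :: "real set"
  assumes "open S" and "x \<in> S" and "smooth_on S f"
    and "deriv f x = 0" and "deriv (deriv f) x \<noteq> 0"
  shows "(\<forall>\<^sub>F h in at_right 0. \<forall>k\<in>{0, 1, 2}. local_smoothness (stencil f x h) k \<noteq> 0) \<and>
    (\<forall>k\<in>{0, 1, 2}.
      (\<lambda>h. nonlinear_weight (stencil f x h) k - ideal_weight k) \<in> O[at_right 0](\<lambda>h. h^3))"
proof -
  let ?z = "\<lambda>h. global_smoothness (stencil f x h)"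
  let ?\<beta> = "\<lambda>k h. local_smoothness (stencil f x h) k"
  have "(deriv ^^ 2) f x \<noteq> 0"
    using assms(5) by (simp add: numeral_2_eq_2)
  note \<beta> = local_smoothness_stencil_bigomega[OF assms(1-3) this]
  have pos: "\<forall>\<^sub>F h::real in at_right 0. h \<noteq> 0"
    by (simp add: eventually_at_filter)
  have nz: "\<forall>\<^sub>F h in at_right 0. ?\<beta> k h \<noteq> 0" if k: "k \<in> {0, 1, 2}" for k
  proof -
    \<comment> \<open>If \<beta>_k vanished, this bound would force
      \<open>h ^ 4 = 0\<close>.\<close>
    obtain C where "\<forall>\<^sub>F h in at_right 0. norm (h ^ 4) \<le> C * norm (?\<beta> k h)"
      using \<beta>[OF k] by (elim landau_o.bigE)
    with pos show ?thesis
      by eventually_elim auto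
  qed
  have ratio: "(\<lambda>h. (?z h / ?\<beta> k h)\<^sup>2) \<in> O[at_right 0](\<lambda>h. h ^ 3)" if k: "k \<in> {0, 1, 2}" for k
  proof -
    have "\<forall>\<^sub>F h::real in at_right 0. h ^ 4 \<noteq> 0"
      using pos by eventually_elim simp
    with nz[OF k] have "(\<lambda>h. ?z h / ?\<beta> k h) \<in> O[at_right 0](\<lambda>h. h ^ 6 / h ^ 4)"
      using global_smoothness_stencil_bigo[OF assms(1-3)] \<beta>[OF k] by (rule landau_o.big.divide)
    from landau_o.big_power[OF this, of 2]
    have "(\<lambda>h. (?z h / ?\<beta> k h)\<^sup>2) \<in> O[at_right 0](\<lambda>h. (h ^ 6 / h ^ 4)\<^sup>2)" .
    \<comment> \<open>For \<open>h\<close> > 0 the left side is \<open>h^4\<close>, one order better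
      than required.\<close>
    also have "(\<lambda>h::real. (h ^ 6 / h ^ 4)\<^sup>2) \<in> O[at_right 0](\<lambda>h. h ^ 3)"
      by real_asymp
    finally show ?thesis .
  qed
  have "(\<lambda>h. nonlinear_weight (stencil f x h) k - ideal_weight k) \<in> O[at_right 0](\<lambda>h. h ^ 3)"
    if k: "k \<in> {0, 1, 2}" for k
  proof -
    \<comment> \<open>The deviation bound holds for all values of \<open>u\<close>, so it applies at
      every \<open>h\<close>.\<close>
    have "(\<lambda>h. nonlinear_weight (stencil f x h) k - ideal_weight k)
        \<in> O[at_right 0](\<lambda>h. \<Sum>j\<in>{0, 1, 2}. (?z h / ?\<beta> j h)\<^sup>2)"
      using nonlinear_weight_deviation[OF k]
      by (intro landau_o.big_mono always_eventually allI)
        (simp only: real_norm_def order.trans[OF _ abs_ge_self])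
    also have "(\<lambda>h. \<Sum>j\<in>{0, 1, 2}. (?z h / ?\<beta> j h)\<^sup>2) \<in> O[at_right 0](\<lambda>h. h ^ 3)"
      by (intro big_sum_in_bigo ratio)
    finally show ?thesis .
  qed
  moreover have "\<forall>\<^sub>F h in at_right 0. \<forall>k\<in>{0, 1, 2}. ?\<beta> k h \<noteq> 0"
    using nz by (intro eventually_ball_finite) auto
  ultimately show ?thesis
    by blast
qed

end
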